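(* Let $(X,GP)$ be a GP-metric space which is GP-complete, and let $\phi:X\times X\to[0,\infty)$ and $T:X\to X$ be two maps. If $\phi$ is a T-lower semi-continuous function on $X\times X$ and $T$ is a Caristi map on $(X,GP)$, that is, $$GP(x,Tx,T^2x)\le\phi(x,Tx)-\phi(Tx,T^2x)\quad\text{for all }x\in X,$$ then $T$ has a fixed point in $X$.
   Context: Let $X$ be a non-empty set. A GP-metric on $X$ is a function $GP:X\times X\times X\to[0,\infty)$ such that for all $x,y,z,a\in X$: (GP1) $0\le GP(x,x,x)\le GP(x,x,y)\le GP(x,y,z)$; (GP2) $GP$ is invariant under all permutations of its three arguments; (GP3) $GP(x,y,z)\le GP(x,a,a)+GP(a,y,z)-GP(a,a,a)$; (GP4) $x=y=z$ if $GP(x,y,z)=GP(x,x,x)=GP(y,y,y)=GP(z,z,z)$. The pair $(X,GP)$ is a GP-metric space. A sequence $\{x_n\}_{n\ge1}$ in $X$ is GP-convergent to $x\in X$ if $GP(x,x,x)=\lim_{n\to\infty}GP(x_n,x_n,x_n)=\lim_{n\to\infty}GP(x,x,x_n)$. It is GP-Cauchy if $\lim_{n,m\to\infty}GP(x_n,x_m,x_m)$ exists and is finite. $(X,GP)$ is GP-complete if every GP-Cauchy sequence $\{y_n\}_{n\ge1}$ converges to a point $x\in X$ such that $GP(x,x,x)=\lim_{n,m\to\infty}GP(y_n,y_m,y_m)$. For $x_0\in X$ and $\varepsilon>0$ put $\beta^{GP}(x_0,\varepsilon)=\{y\in X: GP(x_0,y,y)<\varepsilon+GP(x_0,x_0,x_0)\}$.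 A map $T:X\to X$ is GP-continuous if for every $\varepsilon>0$ and $x_0\in X$ there exists $\delta>0$ such that $T(\beta^{GP}(x_0,\delta))\subseteq\beta^{GP}(Tx_0,\varepsilon)$. Given $\phi:X\times X\to[0,\infty)$ and $T:X\to X$, the function $\phi$ is called T-lower semi-continuous on $X\times X$ if $T$ is GP-continuous and, for every $x\in X$ and every sequence $\{x_n\}$ in $X$ that is GP-convergent to $x$, the following implication holds: $$\lim_{n,m\to\infty}GP(x_n,x_m,Tx_m)=GP(x,x,x)\ \Longrightarrow\ \phi(x,Tx)\le\liminf_{m\to\infty}\phi(x_m,Tx_m)=\sup_{n\ge1}\inf_{m\ge n}\phi(x_m,Tx_m).$$ *)

theory Defs
  imports Complex_Main "HOL-Library.Extended_Real"
begin

locale GP_metric_space =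
  fixes X :: "'a set" and GP :: "'a \<Rightarrow> 'a \<Rightarrow> 'a \<Rightarrow> real"
  assumes nonempty: "X \<noteq> {}"
    and nonneg: "\<lbrakk>x \<in> X; y \<in> X; z \<in> X\<rbrakk> \<Longrightarrow> 0 \<le> GP x y z"
    and GP1: "\<lbrakk>x \<in> X; y \<in> X; z \<in> X\<rbrakk> \<Longrightarrow>
      0 \<le> GP x x x \<and> GP x x x \<le> GP x x y \<and> GP x x y \<le> GP x y z"
    and GP2: "\<lbrakk>x \<in> X; y \<in> X; z \<in> X\<rbrakk> \<Longrightarrow>
      GP x y z = GP x z y \<and> GP x y z = GP y x z \<and> GP x y z = GP y z x \<and>
      GP x y z = GP z x y \<and> GP x y z = GP z y x"
    and GP3: "\<lbrakk>x \<in> X; y \<in> X; z \<in> X; a \<in> X\<rbrakk> \<Longrightarrow>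
      GP x y z \<le> GP x a a + GP a y z - GP a a a"
    and GP4: "\<lbrakk>x \<in> X; y \<in> X; z \<in> X;
      GP x y z = GP x x x; GP x x x = GP y y y; GP y y y = GP z z z\<rbrakk> \<Longrightarrow> x = y \<and> y = z"
begin

text \<open>Sequences are indexed from 0 instead of 1, which affects neither limits nor
  limits inferior. Joint limits in two indices are taken along
  \<open>sequentially \<times>\<^sub>F sequentially\<close>.\<close>

definition GP_convergent :: "(nat \<Rightarrow> 'a) \<Rightarrow> 'a \<Rightarrow> bool" where
  "GP_convergent xs x \<longleftrightarrow> range xs \<subseteq> X \<and> x \<in> X \<and>
     (\<lambda>n. GP (xs n) (xs n) (xs n)) \<longlonglongrightarrow> GP x x x \<and>
     (\<lambda>n. GP x x (xs n)) \<longlonglongrightarrow> GP x x x"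

definition GP_Cauchy :: "(nat \<Rightarrow> 'a) \<Rightarrow> bool" where
  "GP_Cauchy xs \<longleftrightarrow> range xs \<subseteq> X \<and>
     (\<exists>L. ((\<lambda>(n, m). GP (xs n) (xs m) (xs m)) \<longlongrightarrow> L) (sequentially \<times>\<^sub>F sequentially))"

definition GP_complete :: bool where
  "GP_complete \<longleftrightarrow> (\<forall>ys. GP_Cauchy ys \<longrightarrow> (\<exists>x\<in>X. GP_convergent ys x \<and>
     ((\<lambda>(n, m). GP (ys n) (ys m) (ys m)) \<longlongrightarrow> GP x x x) (sequentially \<times>\<^sub>F sequentially)))"

definition GP_ball :: "'a \<Rightarrow> real \<Rightarrow> 'a set" where
  "GP_ball x0 \<epsilon> = {y \<in> X. GP x0 y y < \<epsilon> + GP x0 x0 x0}"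

definition GP_continuous :: "('a \<Rightarrow> 'a) \<Rightarrow> bool" where
  "GP_continuous T \<longleftrightarrow>
     (\<forall>\<epsilon>>0. \<forall>x0\<in>X. \<exists>\<delta>>0. T ` GP_ball x0 \<delta> \<subseteq> GP_ball (T x0) \<epsilon>)"

text \<open>The limit inferior is taken in the extended reals, as it may be infinite.\<close>

definition T_lower_semicontinuous :: "('a \<Rightarrow> 'a) \<Rightarrow> ('a \<Rightarrow> 'a \<Rightarrow> real) \<Rightarrow> bool" where
  "T_lower_semicontinuous T \<phi> \<longleftrightarrow> GP_continuous T \<and>
     (\<forall>x\<in>X. \<forall>xs. GP_convergent xs x \<longrightarrow>
        ((\<lambda>(n, m). GP (xs n) (xs m) (T (xs m))) \<longlongrightarrow> GP x x x) (sequentially \<times>\<^sub>F sequentially) \<longrightarrow>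
        ereal (\<phi> x (T x)) \<le> liminf (\<lambda>m. ereal (\<phi> (xs m) (T (xs m)))))"

definition Caristi_map :: "('a \<Rightarrow> 'a \<Rightarrow> real) \<Rightarrow> ('a \<Rightarrow> 'a) \<Rightarrow> bool" where
  "Caristi_map \<phi> T \<longleftrightarrow>
     (\<forall>x\<in>X. GP x (T x) (T (T x)) \<le> \<phi> x (T x) - \<phi> (T x) (T (T x)))"

end

end

theory Submission
  imports Defs
begin

text \<open>Along an orbit \<open>x\<^sub>n = T\<^sup>n x\<^sub>0\<close> the Caristi inequality telescopes, so the orbit is Cauchy with
  \<open>GP(x\<^sub>n, x\<^sub>m, x\<^sub>m) \<rightarrow> 0\<close> and converges to a point \<open>x\<close> with \<open>GP(x, x, x) = 0\<close>. Continuity alone only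
  yields \<open>GP(Tx, x, x) = GP(Tx, Tx, Tx)\<close>, that is, \<open>x\<close> lies in every ball around \<open>Tx\<close>. This
  relation is preserved by \<open>T\<close>, so the self-distances \<open>GP(T\<^sup>n x, T\<^sup>n x, T\<^sup>n x)\<close> are nondecreasing.
  They also tend to \<open>0\<close>, because the orbit of \<open>x\<close> telescopes as well; hence they all vanish and
  \<open>GP(x, Tx, Tx) = 0\<close>, which forces \<open>Tx = x\<close>.\<close>

context GP_metric_space
begin

lemma GP_pair_commute: "\<lbrakk>x \<in> X; y \<in> X\<rbrakk> \<Longrightarrow> GP x y y = GP y x x"
  using GP1[of x y y] GP1[of y x x] GP2[of x y y] GP2[of y x x] by linarith

lemma GP_self_le: "\<lbrakk>x \<in> X; y \<in> X\<rbrakk> \<Longrightarrow> GP y y y \<le> GP x y y"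
  using GP1[of y x x] GP2[of y y x] by linarith

lemma GP_pair_le: "\<lbrakk>x \<in> X; y \<in> X; z \<in> X\<rbrakk> \<Longrightarrow> GP x y y \<le> GP x y z"
  using GP1[of y x z] GP2[of y y x] GP2[of x y z] by linarith

lemma GP_eq_0_imp_eq:
  assumes "x \<in> X" "y \<in> X" "GP x y y = 0"
  shows "x = y"
proof -
  have "GP x x x = 0" "GP y y y = 0"
    using assms GP_self_le[of x y] GP_self_le[of y x] GP_pair_commute[of x y]
      nonneg[of x x x] nonneg[of y y y] by auto
  then show ?thesis
    using GP4[of x y y] assms by simp
qed

text \<open>The assumption \<open>lim\<close> puts \<open>xs n\<close> eventually in every ball
  around \<open>y\<close>, and continuity carries this over to \<open>T y\<close>. Balls bound
  distances only from above; the lower bound comes from (GP1), since no distance from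
  \<open>T y\<close> falls below its self-distance.\<close>

lemma GP_continuous_tendsto:
  assumes "GP_continuous T" and T: "\<And>x. x \<in> X \<Longrightarrow> T x \<in> X"
    and y: "y \<in> X" and xs: "\<And>n. xs n \<in> X"
    and lim: "(\<lambda>n. GP y (xs n) (xs n)) \<longlonglongrightarrow> GP y y y"
  shows "(\<lambda>n. GP (T y) (T (xs n)) (T (xs n))) \<longlonglongrightarrow> GP (T y) (T y) (T y)"
proof (rule order_tendstoI)
  fix a assume "a < GP (T y) (T y) (T y)"
  moreover have "GP (T y) (T y) (T y) \<le> GP (T y) (T (xs n)) (T (xs n))" for n
    using GP_self_le[of "T (xs n)" "T y"] GP_pair_commute[of "T y" "T (xs n)"] T y xs by simp
  ultimately show "\<forall>\<^sub>F n in sequentially. a < GP (T y) (T (xs n)) (T (xs n))"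
    by (meson always_eventually less_le_trans)
next
  fix a assume "GP (T y) (T y) (T y) < a"
  then obtain \<delta> where \<delta>: "\<delta> > 0"
    "T ` GP_ball y \<delta> \<subseteq> GP_ball (T y) (a - GP (T y) (T y) (T y))"
    using assms(1) y unfolding GP_continuous_def by (meson diff_gt_0_iff_gt)
  have "\<forall>\<^sub>F n in sequentially. GP y (xs n) (xs n) < \<delta> + GP y y y"
    using lim \<delta>(1) by (intro order_tendstoD(2)) auto
  then show "\<forall>\<^sub>F n in sequentially. GP (T y) (T (xs n)) (T (xs n)) < a"
  proof eventually_elim
    case (elim n)
    then have "T (xs n) \<in> GP_ball (T y) (a - GP (T y) (T y) (T y))"
      using \<delta>(2) xs by (auto simp: GP_ball_def)
    then show ?case by (simp add: GP_ball_def)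
  qed
qed

text \<open>The equation \<open>GP y x x = GP y y y\<close> places \<open>x\<close> in every ball
  around \<open>y\<close>, so the constant sequence \<open>x\<close> converges to \<open>y\<close>
  in the sense of the previous lemma.\<close>

lemma GP_continuous_specialization:
  assumes "GP_continuous T" "\<And>x. x \<in> X \<Longrightarrow> T x \<in> X"
    and "x \<in> X" "y \<in> X" "GP y x x = GP y y y"
  shows "GP (T y) (T x) (T x) = GP (T y) (T y) (T y)"
  using GP_continuous_tendsto[OF assms(1,2), of y "\<lambda>_. x"] assms(3-)
  by (simp add: tendsto_const_iff)

text \<open>The bound \<open>e n + e m\<close> separates the indices: it yields the joint limit, and
  for \<open>n = m\<close> the decay of self-distances.\<close>

lemma Caristi_orbit:
  assumes \<phi>: "\<And>x y. x \<in> X \<Longrightarrow> y \<in> X \<Longrightarrow> 0 \<le> \<phi> x y"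
    and T: "\<And>x. x \<in> X \<Longrightarrow> T x \<in> X"
    and Caristi: "Caristi_map \<phi> T" and x: "x \<in> X"
  obtains e where "e \<longlonglongrightarrow> 0"
    and "\<And>n m. GP ((T ^^ n) x) ((T ^^ m) x) ((T ^^ m) x) \<le> e n + e m"
proof -
  define u where "u = (\<lambda>n. (T ^^ n) x)"
  define p where "p = (\<lambda>n. \<phi> (u n) (u (Suc n)))"
  have u: "u n \<in> X" for n by (induction n) (auto simp: u_def x T)
  have step: "GP (u n) (u (Suc n)) (u (Suc n)) \<le> p n - p (Suc n)" for n
    using Caristi u[of n] GP_pair_le[OF u[of n] u[of "Suc n"] u[of "Suc (Suc n)"]]
    unfolding Caristi_map_def p_def by (fastforce simp: u_def)
  have dec: "decseq p"
    by (rule decseq_SucI) (use step nonneg u in \<open>smt (verit)\<close>)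
  obtain c where c: "p \<longlonglongrightarrow> c" "\<And>n. c \<le> p n"
    using decseq_convergent[OF dec, of 0] \<phi> u unfolding p_def by blast
  have self: "GP (u n) (u n) (u n) \<le> p n - p (Suc n)" for n
    using step[of n] GP_self_le[OF u u, of n "Suc n"] GP_pair_commute[OF u u, of n "Suc n"]
    by linarith
  \<comment> \<open>The induction starts at the self-distance of \<open>u n\<close>, which need not
    be 0 and therefore stays as a summand. The self-distance subtracted in (GP3) is nonnegative and
    is dropped.\<close>
  have up: "GP (u n) (u m) (u m) \<le> GP (u n) (u n) (u n) + p n - p m" if "n \<le> m" for n m
    using that
  proof (induction m rule: dec_induct)
    case (step m)
    then show ?case
      using \<open>GP (u m) (u (Suc m)) (u (Suc m)) \<le> p m - p (Suc m)\<close>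
        GP3[OF u u u u, of n "Suc m" "Suc m" m] nonneg[OF u u u, of m m m] by linarith
  qed simp
  have le: "GP (u n) (u m) (u m) \<le> 2 * (p n - c)" if "n \<le> m" for n m
  proof -
    have "GP (u n) (u m) (u m) \<le> p n - p (Suc n) + p n - p m"
      using up[OF that] self[of n] by linarith
    then show ?thesis
      using c(2)[of m] c(2)[of "Suc n"] by (simp add: algebra_simps)
  qed
  have "GP (u n) (u m) (u m) \<le> 2 * (p n - c) + 2 * (p m - c)" for n m
    using le[of n m] le[of m n] GP_pair_commute[OF u u, of n m] c(2)[of n] c(2)[of m]
    by (cases "n \<le> m") auto
  moreover have "(\<lambda>n. 2 * (p n - c)) \<longlonglongrightarrow> 0"
    using tendsto_mult_left[OF LIM_zero[OF c(1)], of 2] by simp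
  ultimately show ?thesis
    using that unfolding u_def by blast
qed

lemma Caristi_fixed_point:
  assumes complete: GP_complete
    and \<phi>: "\<And>x y. x \<in> X \<Longrightarrow> y \<in> X \<Longrightarrow> 0 \<le> \<phi> x y"
    and T: "\<And>x. x \<in> X \<Longrightarrow> T x \<in> X"
    and cont: "GP_continuous T" and Caristi: "Caristi_map \<phi> T"
  shows "\<exists>x\<in>X. T x = x"
proof -
  have orbit: "(T ^^ n) x \<in> X" if "x \<in> X" for n x
    using that by (induction n) (auto simp: T)
  have self_lim: "(\<lambda>n. GP ((T ^^ n) x) ((T ^^ n) x) ((T ^^ n) x)) \<longlonglongrightarrow> 0" if "x \<in> X" for x
  proof -
    obtain e where e: "e \<longlonglongrightarrow> 0"
      "\<And>n m. GP ((T ^^ n) x) ((T ^^ m) x) ((T ^^ m) x) \<le> e n + e m"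
      using Caristi_orbit[OF \<phi> T Caristi \<open>x \<in> X\<close>] by metis
    have "(\<lambda>n. e n + e n) \<longlonglongrightarrow> 0"
      using tendsto_add[OF e(1) e(1)] by simp
    then show ?thesis
      by (rule tendsto_sandwich[OF _ _ tendsto_const, rotated 2])
        (simp_all only: e(2) nonneg orbit that eventually_True)
  qed
  obtain x0 where x0: "x0 \<in> X" using nonempty by blast
  define u where "u = (\<lambda>n. (T ^^ n) x0)"
  have u: "u n \<in> X" for n using orbit x0 by (simp add: u_def)
  obtain e where e: "e \<longlonglongrightarrow> 0" "\<And>n m. GP (u n) (u m) (u m) \<le> e n + e m"
    using Caristi_orbit[OF \<phi> T Caristi x0] unfolding u_def by metis
  have "((\<lambda>q. e (fst q)) \<longlongrightarrow> 0) (sequentially \<times>\<^sub>F sequentially)"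
    "((\<lambda>q. e (snd q)) \<longlongrightarrow> 0) (sequentially \<times>\<^sub>F sequentially)"
    by (rule filterlim_compose[OF e(1)],
        simp add: filterlim_def filtermap_fst_prod_filter filtermap_snd_prod_filter)+
  from tendsto_add[OF this]
  have "((\<lambda>q. e (fst q) + e (snd q)) \<longlongrightarrow> 0) (sequentially \<times>\<^sub>F sequentially)"
    by simp
  then have "((\<lambda>(n, m). GP (u n) (u m) (u m)) \<longlongrightarrow> 0) (sequentially \<times>\<^sub>F sequentially)"
    by (rule tendsto_sandwich[OF _ _ tendsto_const, rotated 2])
      (simp_all add: case_prod_beta e(2) nonneg u)
  then have "GP_Cauchy u"
    using u unfolding GP_Cauchy_def by blast
  then obtain x where x: "x \<in> X" "GP_convergent u x"
    using complete unfolding GP_complete_def by blast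
  \<comment> \<open>The self-distances along the orbit tend to \<open>GP x x x\<close> by
    convergence and to 0 by telescoping.\<close>
  have x_self: "GP x x x = 0"
    using x(2) self_lim[OF x0] LIMSEQ_unique unfolding GP_convergent_def u_def by blast
  have "GP x x (u n) = GP x (u n) (u n)" for n
    using GP2[of x x "u n"] GP_pair_commute[of x "u n"] x(1) u by simp
  then have lim: "(\<lambda>n. GP x (u n) (u n)) \<longlonglongrightarrow> GP x x x"
    using x(2) unfolding GP_convergent_def by simp
  have "(\<lambda>n. GP (T x) (u (Suc n)) (u (Suc n))) \<longlonglongrightarrow> GP (T x) (T x) (T x)"
    using GP_continuous_tendsto[OF cont T x(1) u lim] by (simp add: u_def)
  with LIMSEQ_Suc[OF lim]
  have "(\<lambda>n. GP x (u (Suc n)) (u (Suc n)) + GP (T x) (u (Suc n)) (u (Suc n)))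
      \<longlonglongrightarrow> GP x x x + GP (T x) (T x) (T x)"
    by (rule tendsto_add)
  \<comment> \<open>Limits are not unique here: the shifted orbit approaches both \<open>x\<close>
    and \<open>T x\<close>, and the triangle inequality through it bounds
    \<open>GP x (T x) (T x)\<close> only by the sum of the two self-distances.\<close>
  moreover have "GP x (T x) (T x) \<le> GP x (u n) (u n) + GP (T x) (u n) (u n)" for n
    using GP3[of x "T x" "T x" "u n"] GP_pair_commute[of "T x" "u n"] nonneg[of "u n" "u n" "u n"]
      x(1) T u by fastforce
  ultimately have "GP x (T x) (T x) \<le> GP x x x + GP (T x) (T x) (T x)"
    by (intro LIMSEQ_le_const) auto
  then have base: "GP (T x) x x = GP (T x) (T x) (T x)"
    using x_self GP_self_le[of x "T x"] GP_pair_commute[of x "T x"] x(1) T by fastforce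
  define v where "v = (\<lambda>n. (T ^^ n) x)"
  have v: "v n \<in> X" for n using orbit x(1) by (simp add: v_def)
  have spec: "GP (v (Suc n)) (v n) (v n) = GP (v (Suc n)) (v (Suc n)) (v (Suc n))" for n
  proof (induction n)
    case (Suc n)
    then show ?case
      using GP_continuous_specialization[OF cont T v v, of "Suc n" n] by (simp add: v_def)
  qed (simp add: v_def base)
  \<comment> \<open>By \<open>spec\<close>, the self-distance of \<open>v (Suc n)\<close> equals its
    distance to \<open>v n\<close>, which dominates the self-distance of \<open>v n\<close>.\<close>
  have "incseq (\<lambda>n. GP (v n) (v n) (v n))"
    by (rule incseq_SucI) (metis GP_self_le spec v)
  moreover have "(\<lambda>n. GP (v n) (v n) (v n)) \<longlonglongrightarrow> 0"
    using self_lim[OF x(1)] by (simp add: v_def)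
  \<comment> \<open>A nondecreasing sequence stays below its limit; index 1 is the self-distance of
    \<open>T x\<close>, which \<open>base\<close> identifies with
    \<open>GP (T x) x x\<close>.\<close>
  ultimately have "GP (v 1) (v 1) (v 1) \<le> 0"
    by (rule incseq_le)
  then have "GP (T x) x x = 0"
    using base nonneg[of "T x" "T x" "T x"] T x(1) by (simp add: v_def)
  then show ?thesis
    using GP_eq_0_imp_eq[of "T x" x] T x(1) by blast
qed

end

theorem theorem3p12:
  fixes X :: "'a set" and GP :: "'a \<Rightarrow> 'a \<Rightarrow> 'a \<Rightarrow> real"
    and \<phi> :: "'a \<Rightarrow> 'a \<Rightarrow> real" and T :: "'a \<Rightarrow> 'a"
  assumes "GP_metric_space X GP"
    and "GP_metric_space.GP_complete X GP"
    and "\<And>x y. x \<in> X \<Longrightarrow> y \<in> X \<Longrightarrow> 0 \<le> \<phi> x y"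
    and "\<And>x. x \<in> X \<Longrightarrow> T x \<in> X"
    and "GP_metric_space.T_lower_semicontinuous X GP T \<phi>"
    and "GP_metric_space.Caristi_map X GP \<phi> T"
  shows "\<exists>x\<in>X. T x = x"
proof -
  interpret GP_metric_space X GP by fact
  have "GP_continuous T"
    using assms(5) unfolding T_lower_semicontinuous_def by blast
  then show ?thesis
    using Caristi_fixed_point assms(2-4,6) by blast
qed

end
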